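(* Let $P_n$ be the path graph on $n$ vertices, let $i,j$ be vertices (positive integers, with $n\ge\max(i,j)$), and let $\alpha$ be admissible, i.e. $0<\alpha<1/\rho(A_{P_n})$ for all $n$ under consideration. Then $K_{P_n}(\alpha)_{i,j}$ converges as $n\to\infty$. In fact, \[ \lim_{n\to\infty}K_{P_n}(\alpha)_{i,j}=\alpha^{j-i}\,d_{i-1}(\alpha)\left(\frac{2}{1+\sqrt{1-4\alpha^2}}\right)^{j}. \]
   Context: For a simple graph $G$ with adjacency matrix $A_G$, spectral radius $\rho(A_G)$, and $0<\alpha<1/\rho(A_G)$, the Katz matrix is $K_G(\alpha)=\sum_{t=1}^\infty \alpha^tA_G^t=(I-\alpha A_G)^{-1}-I$, and the Katz similarity index between vertices $i$ and $j$ is the entry $K_G(\alpha)_{i,j}$. $P_n$ is the path graph on vertices $1,\dots,n$ with edges $\{i,i+1\}$, $1\le i<n$. For integers $i\ge0$, $d_i(\alpha)=\sum_{m=0}^{\lfloor i/2\rfloor}(-1)^m\binom{i-m}{m}\alpha^{2m}$.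
   Formalization: The displayed limit is proved as written only for i < j, since it fails otherwise: for i = j the limit is the formula minus 1 (from the "- I" in the Katz matrix), and for i > j it is the formula with i and j exchanged (by symmetry). Convergence is proved for all i, j. *)

theory Defs
  imports "Jordan_Normal_Form.Spectral_Radius"
begin

text \<open>
  A simple graph on the vertices 1, ..., n is given by n and its set E of edges, each edge being
  a two-element set of vertices. Matrices are indexed from 0, so vertex v corresponds to
  row and column v - 1.
\<close>

definition adjacency_matrix :: "nat \<Rightarrow> nat set set \<Rightarrow> real mat" where
  "adjacency_matrix n E = mat n n (\<lambda>(a, b). if {Suc a, Suc b} \<in> E then 1 else 0)"

definition path_edges :: "nat \<Rightarrow> nat set set" where
  "path_edges n = {{i, i + 1} | i. 1 \<le> i \<and> i < n}"

definition adjacency_spectral_radius :: "nat \<Rightarrow> nat set set \<Rightarrow> real" where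
  "adjacency_spectral_radius n E =
     spectral_radius (map_mat complex_of_real (adjacency_matrix n E))"

text \<open>
  For an edgeless graph the spectral radius is 0 and its reciprocal is to be read as infinity,
  whereas 1 / 0 = 0 in HOL; hence the explicit first disjunct.
\<close>

definition katz_admissible :: "nat \<Rightarrow> nat set set \<Rightarrow> real \<Rightarrow> bool" where
  "katz_admissible n E \<alpha> \<longleftrightarrow>
     0 < \<alpha> \<and> (adjacency_spectral_radius n E = 0 \<or> \<alpha> < 1 / adjacency_spectral_radius n E)"

text \<open>
  The matrix series is summed entrywise; the summation index t starts at 0, so that \<open>Suc t\<close> runs
  through the exponents 1, 2, .... The series converges for admissible parameters.
\<close>

definition katz_matrix :: "nat \<Rightarrow> nat set set \<Rightarrow> real \<Rightarrow> real mat" where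
  "katz_matrix n E \<alpha> =
     mat n n (\<lambda>(a, b). \<Sum>t. \<alpha> ^ Suc t * (adjacency_matrix n E ^\<^sub>m Suc t) $$ (a, b))"

definition katz_index :: "nat \<Rightarrow> nat set set \<Rightarrow> real \<Rightarrow> nat \<Rightarrow> nat \<Rightarrow> real" where
  "katz_index n E \<alpha> i j = katz_matrix n E \<alpha> $$ (i - 1, j - 1)"

definition d_poly :: "nat \<Rightarrow> real \<Rightarrow> real" where
  "d_poly i \<alpha> = (\<Sum>m = 0..i div 2. (-1) ^ m * real ((i - m) choose m) * \<alpha> ^ (2 * m))"

end

theory Submission
  imports Defs
begin

text \<open>
  The recurrence \<open>d (k + 2) = d (k + 1) - \<alpha>\<^sup>2 * d k\<close> makes the symmetric matrix \<open>G\<close> with entries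
  \<open>\<alpha> ^ (v - u) * d (u - 1) * d (n - v)\<close> for \<open>u \<le> v\<close> a solution of \<open>G = d n * I + \<alpha> * A * G\<close>.
  Iterating this equation, and using that the powers of \<open>\<alpha> * A\<close> tend to 0, shows that \<open>d n\<close> times
  the Neumann series of \<open>\<alpha> * A\<close> is \<open>G\<close>. The corner entry of \<open>G\<close> is \<open>\<alpha> ^ (n - 1) > 0\<close> and the
  Neumann series has nonnegative terms, so \<open>d n > 0\<close>. A positive orbit of \<open>r \<mapsto> 1 - \<alpha>\<^sup>2 / r\<close>
  forces \<open>\<alpha> \<le> 1 / 2\<close>, since each step decreases \<open>r\<close> by at least \<open>2 * \<alpha> - 1\<close>. Hence the ratios
  \<open>d (n + 1) / d n\<close> decrease from 1 to the larger fixed point \<open>(1 + sqrt (1 - 4 * \<alpha>\<^sup>2)) / 2\<close>.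
\<close>

section \<open>The polynomials \<open>d\<close>: recurrence and addition formula\<close>

text \<open>
  Here \<open>d_shift \<alpha> (k + 1)\<close> is \<open>d k\<close>; the extra value 0 at index 0 lets the equation for \<open>G\<close> hold
  at the end vertices of the path without a case distinction.
\<close>

fun d_shift :: "real \<Rightarrow> nat \<Rightarrow> real" where
  "d_shift \<alpha> 0 = 0"
| "d_shift \<alpha> (Suc 0) = 1"
| "d_shift \<alpha> (Suc (Suc n)) = d_shift \<alpha> (Suc n) - \<alpha>\<^sup>2 * d_shift \<alpha> n"

text \<open>Past \<open>i div 2\<close> the lower binomial index exceeds the upper one. A common
  summation range lets \<open>d_poly\<close> at neighbouring indices be combined term by
  term.\<close>

lemma d_poly_extend:
  assumes "i \<le> K"
  shows "d_poly i \<alpha> = (\<Sum>m\<le>K. (-1) ^ m * real ((i - m) choose m) * \<alpha> ^ (2 * m))"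
  unfolding d_poly_def
proof (rule sum.mono_neutral_left)
  show "{0..i div 2} \<subseteq> {..K}"
    using assms by auto
  show "\<forall>m\<in>{..K} - {0..i div 2}. (-1) ^ m * real ((i - m) choose m) * \<alpha> ^ (2 * m) = 0"
  proof
    fix m assume "m \<in> {..K} - {0..i div 2}"
    then have "i - m < m" by auto
    then show "(-1) ^ m * real ((i - m) choose m) * \<alpha> ^ (2 * m) = 0"
      by (simp add: binomial_eq_0)
  qed
qed simp

lemma d_poly_rec: "d_poly (Suc (Suc i)) \<alpha> = d_poly (Suc i) \<alpha> - \<alpha>\<^sup>2 * d_poly i \<alpha>"
proof -
  let ?f = "\<lambda>k m. (-1) ^ m * real ((k - m) choose m) * \<alpha> ^ (2 * m)"
  have pascal: "?f (Suc (Suc i)) (Suc m) = ?f (Suc i) (Suc m) - \<alpha>\<^sup>2 * ?f i m" if "m \<le> Suc i" for m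
  proof (cases "m \<le> i")
    case True
    then have "Suc (Suc i) - Suc m = Suc (i - m)" "Suc i - Suc m = i - m" by simp_all
    then show ?thesis
      by (simp only:) (simp add: algebra_simps power2_eq_square)
  next
    \<comment> \<open>Truncated subtraction turns all three binomials into 0 choose a positive
      number.\<close>
    case False
    with that have "m = Suc i" by simp
    then show ?thesis by simp
  qed
  have "d_poly (Suc (Suc i)) \<alpha> = (\<Sum>m\<le>Suc (Suc i). ?f (Suc (Suc i)) m)"
    by (rule d_poly_extend) simp
  also have "\<dots> = 1 + (\<Sum>m\<le>Suc i. ?f (Suc (Suc i)) (Suc m))"
    by (subst sum.atMost_Suc_shift) simp
  also have "\<dots> = 1 + (\<Sum>m\<le>Suc i. ?f (Suc i) (Suc m) - \<alpha>\<^sup>2 * ?f i m)"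
    using pascal by (intro arg_cong2[where f = "(+)"] sum.cong) auto
  also have "\<dots> = (1 + (\<Sum>m\<le>Suc i. ?f (Suc i) (Suc m))) - \<alpha>\<^sup>2 * (\<Sum>m\<le>Suc i. ?f i m)"
    by (simp only: sum_subtractf sum_distrib_left add_diff_eq)
  also have "1 + (\<Sum>m\<le>Suc i. ?f (Suc i) (Suc m)) = (\<Sum>m\<le>Suc (Suc i). ?f (Suc i) m)"
    by (subst sum.atMost_Suc_shift[of _ "Suc i"]) simp
  also have "\<dots> = d_poly (Suc i) \<alpha>"
    by (rule d_poly_extend[symmetric]) simp
  also have "(\<Sum>m\<le>Suc i. ?f i m) = d_poly i \<alpha>"
    by (rule d_poly_extend[symmetric]) simp
  finally show ?thesis .
qed

lemma d_shift_Suc: "d_shift \<alpha> (Suc k) = d_poly k \<alpha>"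
proof (induction k rule: less_induct)
  case (less k)
  consider "k = 0" | "k = Suc 0" | l where "k = Suc (Suc l)"
    by (metis not0_implies_Suc)
  then show ?case
  proof cases
    case 3
    then show ?thesis
      using less[of l] less[of "Suc l"] by (simp add: d_poly_rec)
  qed (simp_all add: d_poly_def)
qed

text \<open>Analogue of the Fibonacci addition formula: the induction moves one unit from
  \<open>m\<close> to \<open>n\<close>. It provides the diagonal case of the kernel
  equation.\<close>

lemma d_shift_add:
  "d_shift \<alpha> (Suc (m + n)) =
    d_shift \<alpha> (Suc m) * d_shift \<alpha> (Suc n) - \<alpha>\<^sup>2 * d_shift \<alpha> m * d_shift \<alpha> n"
proof (induction \<alpha> m arbitrary: n rule: d_shift.induct)
  case (3 \<alpha> m)
  show ?case
    using "3.IH"(1)[of "Suc n"] by (simp add: algebra_simps)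
qed simp_all

section \<open>Decay of scaled matrix powers\<close>

lemma pow_smult_mat:
  fixes A :: "'a :: comm_semiring_1 mat"
  assumes "A \<in> carrier_mat n n"
  shows "(c \<cdot>\<^sub>m A) ^\<^sub>m k = c ^ k \<cdot>\<^sub>m (A ^\<^sub>m k)"
proof (induction k)
  case 0
  then show ?case using assms by auto
next
  case (Suc k)
  have pow: "A ^\<^sub>m k \<in> carrier_mat n n"
    using assms by simp
  have "(c \<cdot>\<^sub>m A) ^\<^sub>m Suc k = (c ^ k \<cdot>\<^sub>m (A ^\<^sub>m k)) * (c \<cdot>\<^sub>m A)"
    using Suc by simp
  also have "\<dots> = c ^ Suc k \<cdot>\<^sub>m (A ^\<^sub>m Suc k)"
    using assms pow by (intro eq_matI) (auto simp: mult_ac)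
  finally show ?case .
qed

lemma eigenvalue_smult_mat:
  fixes A :: "'a :: field mat"
  assumes "A \<in> carrier_mat n n" "c \<noteq> 0" "eigenvalue (c \<cdot>\<^sub>m A) k"
  shows "eigenvalue A (k / c)"
proof -
  obtain v where v: "v \<in> carrier_vec n" "v \<noteq> 0\<^sub>v n" and eq: "(c \<cdot>\<^sub>m A) *\<^sub>v v = k \<cdot>\<^sub>v v"
    using assms by (auto simp: eigenvalue_def eigenvector_def)
  have "A *\<^sub>v v = (k / c) \<cdot>\<^sub>v v"
  proof (rule eq_vecI)
    fix l assume "l < dim_vec ((k / c) \<cdot>\<^sub>v v)"
    then have l: "l < n" using v by simp
    have "((c \<cdot>\<^sub>m A) *\<^sub>v v) $ l = (k \<cdot>\<^sub>v v) $ l"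
      by (simp only: eq)
    then have "c * (row A l \<bullet> v) = k * v $ l"
      using l v assms by simp
    then show "(A *\<^sub>v v) $ l = ((k / c) \<cdot>\<^sub>v v) $ l"
      using l v assms by (simp add: field_simps)
  qed (use v assms in auto)
  then show ?thesis
    using v assms by (auto simp: eigenvalue_def eigenvector_def)
qed

lemma spectral_radius_smult_mat_le:
  assumes "A \<in> carrier_mat n n" "0 < n" "c \<noteq> 0"
  shows "spectral_radius (c \<cdot>\<^sub>m A) \<le> norm c * spectral_radius A"
proof -
  have cA: "c \<cdot>\<^sub>m A \<in> carrier_mat n n"
    using assms by simp
  obtain k where k: "eigenvalue (c \<cdot>\<^sub>m A) k" "spectral_radius (c \<cdot>\<^sub>m A) = norm k"
    using spectral_radius_mem_max(1)[OF cA \<open>0 < n\<close>] by (auto simp: spectrum_def)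
  have "norm (k / c) \<le> spectral_radius A"
    using eigenvalue_smult_mat[OF assms(1,3) k(1)] spectral_radius_mem_max(2)[OF assms(1,2)]
    by (auto simp: spectrum_def)
  then show ?thesis
    using k(2) assms(3) by (simp add: norm_divide field_simps)
qed

text \<open>Choose \<beta> > \<alpha> with \<beta> * \<rho> < 1. The Jordan normal form, over the
  complex numbers, bounds all powers of \<beta> * A uniformly, and the factor
  \<open>(\<alpha> / \<beta>) ^ t\<close> remains to force decay.\<close>

lemma power_mat_entry_tendsto_0:
  fixes A :: "real mat" and \<alpha> :: real
  defines "\<rho> \<equiv> spectral_radius (map_mat complex_of_real A)"
  assumes A: "A \<in> carrier_mat n n" and "0 < \<alpha>" and adm: "\<rho> = 0 \<or> \<alpha> < 1 / \<rho>"
    and a: "a < n" and b: "b < n"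
  shows "(\<lambda>t. \<alpha> ^ t * (A ^\<^sub>m t) $$ (a, b)) \<longlonglongrightarrow> 0"
proof -
  define C where "C = map_mat complex_of_real A"
  have C: "C \<in> carrier_mat n n" and "0 < n"
    using A a by (auto simp: C_def)
  have "0 \<le> \<rho>"
    using spectral_radius_mem_max(1)[OF C \<open>0 < n\<close>] by (auto simp: \<rho>_def C_def)
  obtain \<beta> where \<beta>: "\<alpha> < \<beta>" "\<beta> * \<rho> < 1"
  proof (cases "\<rho> = 0")
    case True
    then show ?thesis using that[of "\<alpha> + 1"] by simp
  next
    case False
    then have "\<alpha> < 1 / \<rho>" using adm by simp
    then obtain \<beta> where "\<alpha> < \<beta>" "\<beta> < 1 / \<rho>" using dense by blast
    then show ?thesis using that[of \<beta>] False \<open>0 \<le> \<rho>\<close> by (simp add: field_simps)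
  qed
  have "0 < \<beta>" using \<beta> \<open>0 < \<alpha>\<close> by simp
  have "spectral_radius (complex_of_real \<beta> \<cdot>\<^sub>m C) < 1"
    using spectral_radius_smult_mat_le[OF C \<open>0 < n\<close>, of "complex_of_real \<beta>"] \<open>0 < \<beta>\<close> \<beta>(2)
    by (simp add: \<rho>_def C_def)
  then obtain c where c: "norm_bound ((complex_of_real \<beta> \<cdot>\<^sub>m C) ^\<^sub>m k) c" for k
    using spectral_radius_jnf_norm_bound_less_1_upper_triangular[of "complex_of_real \<beta> \<cdot>\<^sub>m C" n] C
    by auto
  have bound: "\<bar>\<beta> ^ t * (A ^\<^sub>m t) $$ (a, b)\<bar> \<le> c" for t
  proof -
    have "(complex_of_real \<beta> \<cdot>\<^sub>m C) ^\<^sub>m t = complex_of_real \<beta> ^ t \<cdot>\<^sub>m map_mat complex_of_real (A ^\<^sub>m t)"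
      unfolding C_def of_real_hom.mat_hom_pow[OF A]
      by (rule pow_smult_mat) (use A in auto)
    then have "((complex_of_real \<beta> \<cdot>\<^sub>m C) ^\<^sub>m t) $$ (a, b) =
        complex_of_real (\<beta> ^ t * (A ^\<^sub>m t) $$ (a, b))"
      using A a b by simp
    moreover have "norm (((complex_of_real \<beta> \<cdot>\<^sub>m C) ^\<^sub>m t) $$ (a, b)) \<le> c"
      using c[of t] C a b by (simp add: norm_bound_def)
    ultimately show ?thesis
      by (metis norm_of_real)
  qed
  have "(\<lambda>t. c * (\<alpha> / \<beta>) ^ t) \<longlonglongrightarrow> c * 0"
    using \<beta>(1) \<open>0 < \<alpha>\<close> by (intro tendsto_mult tendsto_const LIMSEQ_power_zero) simp
  then have lim: "(\<lambda>t. c * (\<alpha> / \<beta>) ^ t) \<longlonglongrightarrow> 0"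
    by simp
  have "\<bar>\<alpha> ^ t * (A ^\<^sub>m t) $$ (a, b)\<bar> \<le> c * (\<alpha> / \<beta>) ^ t" for t
  proof -
    have "\<bar>\<alpha> ^ t * (A ^\<^sub>m t) $$ (a, b)\<bar> = (\<alpha> / \<beta>) ^ t * \<bar>\<beta> ^ t * (A ^\<^sub>m t) $$ (a, b)\<bar>"
      using \<open>0 < \<alpha>\<close> \<open>0 < \<beta>\<close> by (simp add: abs_mult power_divide)
    also have "\<dots> \<le> (\<alpha> / \<beta>) ^ t * c"
      using bound \<open>0 < \<alpha>\<close> \<open>0 < \<beta>\<close> by (intro mult_left_mono) simp_all
    finally show ?thesis
      by (simp add: mult.commute)
  qed
  then show ?thesis
    by (intro tendsto_rabs_zero_cancel[OF tendsto_sandwich[OF _ _ tendsto_const lim]]) simp_all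
qed

section \<open>Neumann series from a linear equation\<close>

lemma pow_mat_Suc_index:
  fixes A :: "'a :: semiring_1 mat"
  assumes "A \<in> carrier_mat n n" "a < n" "b < n"
  shows "(A ^\<^sub>m Suc t) $$ (a, b) = (\<Sum>l<n. (A ^\<^sub>m t) $$ (a, l) * A $$ (l, b))"
  using assms by (auto simp: scalar_prod_def lessThan_atLeast0 intro!: sum.cong)

text \<open>The factor \<open>c\<close> stays inside the series because it is later
  \<open>d n\<close>, whose sign is itself deduced from this sum.\<close>

lemma neumann_series_sums:
  fixes A :: "real mat"
  assumes A: "A \<in> carrier_mat n n" and a: "a < n" and b: "b < n"
    and null: "\<And>l. l < n \<Longrightarrow> (\<lambda>t. \<alpha> ^ t * (A ^\<^sub>m t) $$ (a, l)) \<longlonglongrightarrow> 0"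
    and g: "\<And>l. l < n \<Longrightarrow> g l = (if l = b then c else 0) + \<alpha> * (\<Sum>k<n. A $$ (l, k) * g k)"
  shows "(\<lambda>t. c * (\<alpha> ^ t * (A ^\<^sub>m t) $$ (a, b))) sums g a"
proof -
  let ?s = "\<lambda>T. \<Sum>t<T. c * (\<alpha> ^ t * (A ^\<^sub>m t) $$ (a, b))"
  let ?r = "\<lambda>T. \<Sum>l<n. \<alpha> ^ T * (A ^\<^sub>m T) $$ (a, l) * g l"
  \<comment> \<open>Inserting the equation for \<open>g\<close> into the remainder splits off the
    term of exponent \<open>T\<close>; swapping the double sum gathers the rest into row
    \<open>a\<close> of the next power.\<close>
  have step: "?r T = c * (\<alpha> ^ T * (A ^\<^sub>m T) $$ (a, b)) + ?r (Suc T)" for T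
  proof -
    have "?r T = (\<Sum>l<n. \<alpha> ^ T * (A ^\<^sub>m T) $$ (a, l) *
        ((if l = b then c else 0) + \<alpha> * (\<Sum>k<n. A $$ (l, k) * g k)))"
      by (intro sum.cong refl arg_cong2[where f = "(*)"] g) simp_all
    also have "\<dots> = (\<Sum>l<n. if l = b then \<alpha> ^ T * (A ^\<^sub>m T) $$ (a, l) * c else 0) +
        (\<Sum>l<n. \<Sum>k<n. \<alpha> ^ Suc T * ((A ^\<^sub>m T) $$ (a, l) * A $$ (l, k)) * g k)"
      unfolding sum.distrib[symmetric]
      by (intro sum.cong) (auto simp: sum_distrib_left algebra_simps)
    also have "(\<Sum>l<n. \<Sum>k<n. \<alpha> ^ Suc T * ((A ^\<^sub>m T) $$ (a, l) * A $$ (l, k)) * g k) = ?r (Suc T)"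
      unfolding pow_mat_Suc_index[OF A a]
      by (subst sum.swap, intro sum.cong)
        (simp_all only: lessThan_iff pow_mat_Suc_index[OF A a] sum_distrib_left sum_distrib_right)
    finally show ?thesis
      using b by (simp add: mult_ac)
  qed
  have "g a = ?s T + ?r T" for T
  proof (induction T)
    case 0
    have "?r 0 = (\<Sum>l<n. if l = a then g l else 0)"
      using A a by (intro sum.cong) auto
    then show ?case using a by simp
  next
    case (Suc T)
    then show ?case using step[of T] by simp
  qed
  then have s: "?s = (\<lambda>T. g a - ?r T)"
    by (auto simp: fun_eq_iff algebra_simps)
  have "(\<lambda>T. g a - ?r T) \<longlonglongrightarrow> g a - (\<Sum>l<n. 0 * g l)"
    by (intro tendsto_intros null) auto
  then show ?thesis
    unfolding sums_def s by simp
qed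

section \<open>Adjacency matrix of the path\<close>

lemma adjacency_matrix_carrier [simp]: "adjacency_matrix n E \<in> carrier_mat n n"
  by (simp add: adjacency_matrix_def)

lemma adjacency_matrix_pow_nonneg:
  assumes "a < n" "b < n"
  shows "0 \<le> (adjacency_matrix n E ^\<^sub>m t) $$ (a, b)"
  using assms(2)
proof (induction t arbitrary: b)
  case 0
  then show ?case using assms by (simp add: adjacency_matrix_def)
next
  case (Suc t)
  then show ?case
    unfolding pow_mat_Suc_index[OF adjacency_matrix_carrier assms(1) Suc.prems]
    by (intro sum_nonneg mult_nonneg_nonneg) (auto simp: adjacency_matrix_def)
qed

lemma path_adjacency_index:
  assumes "a < n" "b < n"
  shows "adjacency_matrix n (path_edges n) $$ (a, b) = (if b = Suc a \<or> a = Suc b then 1 else 0)"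
proof -
  have "{Suc a, Suc b} \<in> path_edges n \<longleftrightarrow> b = Suc a \<or> a = Suc b"
    using assms unfolding path_edges_def by (auto simp: doubleton_eq_iff)
  then show ?thesis
    using assms by (simp add: adjacency_matrix_def)
qed

text \<open>Row \<open>l\<close> is vertex \<open>l + 1\<close>, with neighbours \<open>l\<close>
  and \<open>l + 2\<close>. Zero values at the fictitious vertices 0 and \<open>n + 1\<close> treat
  the ends like inner vertices.\<close>

lemma path_adjacency_sum:
  assumes "l < n" "g 0 = 0" "g (Suc n) = 0"
  shows "(\<Sum>k<n. adjacency_matrix n (path_edges n) $$ (l, k) * g (Suc k)) = g l + g (Suc (Suc l))"
proof -
  have "(\<Sum>k<n. adjacency_matrix n (path_edges n) $$ (l, k) * g (Suc k)) =
      (\<Sum>k<n. (if k = Suc l then g (Suc k) else 0) + (if Suc k = l then g (Suc k) else 0))"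
    using assms(1) by (intro sum.cong) (auto simp: path_adjacency_index)
  also have "\<dots> = (\<Sum>k<n. if k = Suc l then g (Suc k) else 0) +
      (\<Sum>k<n. if Suc k = l then g (Suc k) else 0)"
    by (rule sum.distrib)
  also have "(\<Sum>k<n. if k = Suc l then g (Suc k) else 0) = g (Suc (Suc l))"
    using assms by (cases "Suc l = n") auto
  also have "(\<Sum>k<n. if Suc k = l then g (Suc k) else 0) = g l"
    using assms by (cases l) auto
  finally show ?thesis by simp
qed

section \<open>The kernel and the closed form of the Katz index\<close>

text \<open>For vertices \<open>u\<close>, \<open>v\<close> of the path this is the entry of the
  adjugate of \<open>I - \<alpha> * A\<close>, whose determinant is \<open>d n\<close>. The two
  \<open>d_shift\<close> factors are the determinants of the pieces outside the segment from
  \<open>u\<close> to \<open>v\<close>.\<close>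

definition path_kernel :: "real \<Rightarrow> nat \<Rightarrow> nat \<Rightarrow> nat \<Rightarrow> real" where
  "path_kernel \<alpha> n u v =
    \<alpha> ^ (max u v - min u v) * d_shift \<alpha> (min u v) * d_shift \<alpha> (Suc n - max u v)"

lemma path_kernel_le:
  "u \<le> v \<Longrightarrow> path_kernel \<alpha> n u v = \<alpha> ^ (v - u) * d_shift \<alpha> u * d_shift \<alpha> (Suc n - v)"
  by (simp add: path_kernel_def max_def min_def)

lemma path_kernel_ge:
  "v \<le> u \<Longrightarrow> path_kernel \<alpha> n u v = \<alpha> ^ (u - v) * d_shift \<alpha> v * d_shift \<alpha> (Suc n - u)"
  by (simp add: path_kernel_def max_def min_def)

text \<open>Off the diagonal this is the three-term recurrence of \<open>d_shift\<close>, applied to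
  the factor that depends on \<open>u\<close>.\<close>

lemma path_kernel_rec:
  assumes "u < n" "1 \<le> v" "v \<le> n"
  shows "path_kernel \<alpha> n (Suc u) v = (if Suc u = v then d_shift \<alpha> (Suc n) else 0) +
    \<alpha> * (path_kernel \<alpha> n u v + path_kernel \<alpha> n (Suc (Suc u)) v)"
proof (cases "Suc u" v rule: linorder_cases)
  case less
  then obtain m where v: "v = Suc (Suc u) + m"
    using less_iff_Suc_add by auto
  have m: "Suc (Suc u) + m - u = Suc (Suc m)" "Suc (Suc u) + m - Suc u = Suc m"
    by simp_all
  show ?thesis
    unfolding v by (simp add: path_kernel_le m algebra_simps power2_eq_square)
next
  case equal
  obtain w where n: "n = Suc (u + w)"
    using assms(1) less_iff_Suc_add by auto
  show ?thesis
    \<comment> \<open>Here the neighbours of \<open>v\<close> lie on different branches of the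
      kernel; the addition formula identifies the defect as \<open>d n\<close>.\<close>
    unfolding n equal[symmetric] using d_shift_add[of \<alpha> u "Suc w"]
    by (simp add: path_kernel_le path_kernel_ge Suc_diff_le algebra_simps power2_eq_square)
next
  case greater
  then obtain m where u: "u = v + m"
    using less_Suc_eq_le le_Suc_ex by blast
  obtain w where n: "n = Suc (u + w)"
    using assms(1) less_iff_Suc_add by auto
  have "Suc n - u = Suc (Suc w)" "Suc n - Suc u = Suc w" "Suc n - Suc (Suc u) = w"
    "Suc u - v = Suc m" "u - v = m" "Suc (Suc u) - v = Suc (Suc m)"
    by (simp_all add: n u)
  then show ?thesis
    using greater by (simp add: path_kernel_ge algebra_simps power2_eq_square)
qed

lemma path_neumann_sums:
  assumes adm: "katz_admissible n (path_edges n) \<alpha>" and a: "a < n" and b: "b < n"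
  shows "(\<lambda>t. d_shift \<alpha> (Suc n) * (\<alpha> ^ t * (adjacency_matrix n (path_edges n) ^\<^sub>m t) $$ (a, b)))
    sums path_kernel \<alpha> n (Suc a) (Suc b)"
proof (rule neumann_series_sums[where g = "\<lambda>l. path_kernel \<alpha> n (Suc l) (Suc b)",
      OF adjacency_matrix_carrier a b])
  fix l assume l: "l < n"
  show "(\<lambda>t. \<alpha> ^ t * (adjacency_matrix n (path_edges n) ^\<^sub>m t) $$ (a, l)) \<longlonglongrightarrow> 0"
    by (rule power_mat_entry_tendsto_0[OF adjacency_matrix_carrier _ _ a l])
      (use adm in \<open>auto simp: katz_admissible_def adjacency_spectral_radius_def\<close>)
  \<comment> \<open>At 0 and at \<open>Suc n\<close> the kernel contains the factor
    \<open>d_shift \<alpha> 0\<close>, so it vanishes there.\<close>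
  have "(\<Sum>k<n. adjacency_matrix n (path_edges n) $$ (l, k) * path_kernel \<alpha> n (Suc k) (Suc b)) =
      path_kernel \<alpha> n l (Suc b) + path_kernel \<alpha> n (Suc (Suc l)) (Suc b)"
    by (rule path_adjacency_sum[where g = "\<lambda>k. path_kernel \<alpha> n k (Suc b)", OF l])
      (use b in \<open>simp_all add: path_kernel_le path_kernel_ge\<close>)
  then show "path_kernel \<alpha> n (Suc l) (Suc b) = (if l = b then d_shift \<alpha> (Suc n) else 0) +
      \<alpha> * (\<Sum>k<n. adjacency_matrix n (path_edges n) $$ (l, k) * path_kernel \<alpha> n (Suc k) (Suc b))"
    using path_kernel_rec[of l n "Suc b" \<alpha>] l b by simp
qed

text \<open>Between the two end vertices both \<open>d_shift\<close> factors of the kernel are 1, so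
  the sum is a positive power of \<alpha>. Nonnegative walk counts times a nonpositive
  \<open>d n\<close> could not reach it.\<close>

lemma d_shift_pos_of_admissible:
  assumes "katz_admissible n (path_edges n) \<alpha>" "1 \<le> n"
  shows "0 < d_shift \<alpha> (Suc n)"
proof -
  let ?x = "\<lambda>t. \<alpha> ^ t * (adjacency_matrix n (path_edges n) ^\<^sub>m t) $$ (0, n - 1)"
  have "0 < \<alpha>"
    using assms by (simp add: katz_admissible_def)
  have sums: "(\<lambda>t. d_shift \<alpha> (Suc n) * ?x t) sums \<alpha> ^ (n - 1)"
    using path_neumann_sums[OF assms(1), of 0 "n - 1"] assms(2) by (simp add: path_kernel_le)
  have nonneg: "0 \<le> ?x t" for t
    using \<open>0 < \<alpha>\<close> assms(2) by (simp add: adjacency_matrix_pow_nonneg)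
  show ?thesis
  proof (rule ccontr)
    assume "\<not> ?thesis"
    then have "d_shift \<alpha> (Suc n) * ?x t \<le> 0" for t
      using nonneg[of t] by (intro mult_nonpos_nonneg) simp_all
    then have "\<alpha> ^ (n - 1) \<le> 0"
      using sums_le[OF _ sums sums_zero] by blast
    then show False
      using zero_less_power[OF \<open>0 < \<alpha>\<close>, of "n - 1"] by linarith
  qed
qed

text \<open>The Katz series starts at exponent 1, so the identity matrix at \<open>t = 0\<close> is
  subtracted.\<close>

lemma path_katz_index:
  assumes adm: "katz_admissible n (path_edges n) \<alpha>" and "1 \<le> i" "1 \<le> j" "i \<le> n" "j \<le> n"
  shows "katz_index n (path_edges n) \<alpha> i j =
    path_kernel \<alpha> n i j / d_shift \<alpha> (Suc n) - (if i = j then 1 else 0)"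
proof -
  let ?x = "\<lambda>t. \<alpha> ^ t * (adjacency_matrix n (path_edges n) ^\<^sub>m t) $$ (i - 1, j - 1)"
  have pos: "0 < d_shift \<alpha> (Suc n)"
    using d_shift_pos_of_admissible adm assms by simp
  have "(\<lambda>t. d_shift \<alpha> (Suc n) * ?x t / d_shift \<alpha> (Suc n)) sums
      (path_kernel \<alpha> n i j / d_shift \<alpha> (Suc n))"
    using path_neumann_sums[OF adm, of "i - 1" "j - 1"] assms by (intro sums_divide) simp
  then have "?x sums (path_kernel \<alpha> n i j / d_shift \<alpha> (Suc n))"
    using pos by simp
  then have "(\<lambda>t. ?x (Suc t)) sums (path_kernel \<alpha> n i j / d_shift \<alpha> (Suc n) - ?x 0)"
    by (subst sums_Suc_iff) (simp only: diff_add_cancel)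
  moreover have "?x 0 = (if i = j then 1 else 0)"
    using assms by (auto simp: adjacency_matrix_def)
  ultimately show ?thesis
    using assms unfolding katz_index_def katz_matrix_def by (simp add: sums_unique[symmetric])
qed

section \<open>Ratios of consecutive values of \<open>d\<close>\<close>

text \<open>If \<open>d_shift \<alpha> m\<close> is 0, division by zero yields 0 in both quotients
  on the right, and both sides are 1.\<close>

lemma d_shift_ratio_rec:
  assumes "d_shift \<alpha> (Suc m) \<noteq> 0"
  shows "d_shift \<alpha> (Suc (Suc m)) / d_shift \<alpha> (Suc m) =
    1 - \<alpha>\<^sup>2 / (d_shift \<alpha> (Suc m) / d_shift \<alpha> m)"
  using assms by (simp add: diff_divide_distrib)

text \<open>Takes the place of the explicit spectral radii 2 cos(pi / (n + 1)), which tend to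
  2.\<close>

lemma admissible_parameter_le_half:
  assumes "0 < \<alpha>" and pos: "\<And>n. N \<le> n \<Longrightarrow> 0 < d_shift \<alpha> n"
  shows "\<alpha> \<le> 1 / 2"
proof (rule ccontr)
  assume "\<not> \<alpha> \<le> 1 / 2"
  then have big: "0 < 2 * \<alpha> - 1" by simp
  define r where "r k = d_shift \<alpha> (Suc (N + k)) / d_shift \<alpha> (N + k)" for k
  have r_pos: "0 < r k" for k
    unfolding r_def by (intro divide_pos_pos pos) simp_all
  have step: "r (Suc k) \<le> r k - (2 * \<alpha> - 1)" for k
  proof -
    have "r (Suc k) = 1 - \<alpha>\<^sup>2 / r k"
      using pos[of "Suc (N + k)"] d_shift_ratio_rec[of \<alpha> "N + k"]
      by (simp add: r_def del: d_shift.simps)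
    \<comment> \<open>This is the square of \<open>r k - \<alpha>\<close> being nonnegative, divided
      by \<open>r k\<close>.\<close>
    moreover have "2 * \<alpha> \<le> r k + \<alpha>\<^sup>2 / r k"
      using r_pos[of k] zero_le_power2[of "r k - \<alpha>"]
      by (simp add: field_simps power2_eq_square)
    ultimately show ?thesis by simp
  qed
  have bound: "r k \<le> r 0 - real k * (2 * \<alpha> - 1)" for k
  proof (induction k)
    case (Suc k)
    then show ?case using step[of k] by (simp add: algebra_simps)
  qed simp
  obtain k where "r 0 < real k * (2 * \<alpha> - 1)"
    using reals_Archimedean3[OF big] by blast
  then show False
    using bound[of k] r_pos[of k] by simp
qed

lemma d_shift_ratio:
  assumes "0 < \<alpha>" "\<alpha> \<le> 1 / 2"
  defines "\<mu> \<equiv> (1 + sqrt (1 - 4 * \<alpha>\<^sup>2)) / 2"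
  shows "0 < d_shift \<alpha> (Suc n)"
    and "(\<lambda>n. d_shift \<alpha> (Suc (Suc n)) / d_shift \<alpha> (Suc n)) \<longlonglongrightarrow> \<mu>"
proof -
  have "\<alpha>\<^sup>2 \<le> (1 / 2)\<^sup>2"
    using assms by (intro power_mono) simp_all
  then have disc: "0 \<le> 1 - 4 * \<alpha>\<^sup>2"
    by (simp add: power2_eq_square)
  have "1 - 4 * \<alpha>\<^sup>2 \<le> 1" by simp
  then have sqrt_bounds: "0 \<le> sqrt (1 - 4 * \<alpha>\<^sup>2)" "sqrt (1 - 4 * \<alpha>\<^sup>2) \<le> 1"
    using disc by simp_all
  then have \<mu>: "1 / 2 \<le> \<mu>" "\<mu> \<le> 1"
    by (simp_all add: \<mu>_def)
  \<comment> \<open>\<mu> and 1 - \<mu> are the roots of x^2 - x + \<alpha>^2, hence the fixed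
    points of the ratio map.\<close>
  have root: "\<mu> * (1 - \<mu>) = \<alpha>\<^sup>2"
    using disc by (simp add: \<mu>_def field_simps flip: power2_eq_square)
  have \<mu>_fix: "1 - \<alpha>\<^sup>2 / \<mu> = \<mu>"
    using \<mu> root by (simp add: field_simps)
  define r where "r n = d_shift \<alpha> (Suc (Suc n)) / d_shift \<alpha> (Suc n)" for n
  have inv: "0 < d_shift \<alpha> (Suc n) \<and> \<mu> \<le> r n" for n
  proof (induction n)
    case 0
    then show ?case using \<mu> by (simp add: r_def)
  next
    case (Suc n)
    then have "0 < r n" using \<mu> by simp
    then have pos: "0 < d_shift \<alpha> (Suc (Suc n))"
      using Suc by (simp add: r_def zero_less_divide_iff del: d_shift.simps)
    have "r (Suc n) = 1 - \<alpha>\<^sup>2 / r n"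
      using pos unfolding r_def by (intro d_shift_ratio_rec) simp
    moreover have "\<alpha>\<^sup>2 / r n \<le> \<alpha>\<^sup>2 / \<mu>"
      using Suc \<mu> by (intro divide_left_mono) auto
    ultimately show ?case
      using pos \<mu>_fix by simp
  qed
  then show "0 < d_shift \<alpha> (Suc n)" by blast
  have r_pos: "0 < r n" for n
    using inv[of n] \<mu> by simp
  have rec: "r (Suc n) = 1 - \<alpha>\<^sup>2 / r n" for n
    using inv[of "Suc n"] unfolding r_def by (intro d_shift_ratio_rec) simp
  have decr: "r (Suc n) \<le> r n" for n
  proof -
    \<comment> \<open>The product equals \<open>r n\<close> times the drop from \<open>r n\<close>
      to \<open>r (Suc n)\<close>; its second factor is nonnegative because 1 - \<mu> \<le>
      \<mu>.\<close>
    have "0 \<le> (r n - \<mu>) * (r n - (1 - \<mu>))"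
      using inv[of n] \<mu> by (intro mult_nonneg_nonneg) auto
    then have "0 \<le> r n * r n - r n + \<alpha>\<^sup>2"
      unfolding root[symmetric] by (simp add: algebra_simps)
    then show ?thesis
      unfolding rec using r_pos[of n] by (simp add: field_simps)
  qed
  have "decseq r"
    using decr by (simp add: decseq_Suc_iff)
  then obtain L where L: "r \<longlonglongrightarrow> L"
    by (rule decseq_convergent[where B = \<mu>]) (use inv in auto)
  have "\<mu> \<le> L"
    by (rule LIMSEQ_le_const[OF L]) (use inv in auto)
  have "(\<lambda>n. r (Suc n)) \<longlonglongrightarrow> 1 - \<alpha>\<^sup>2 / L"
    unfolding rec using L \<open>\<mu> \<le> L\<close> \<mu> by (intro tendsto_intros) auto
  then have "1 - \<alpha>\<^sup>2 / L = L"
    using LIMSEQ_Suc[OF L] by (rule LIMSEQ_unique)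
  \<comment> \<open>The limit is a fixed point, and L \<ge> \<mu> selects the larger one; at
    \<alpha> = 1/2 the two coincide.\<close>
  then have "(L - \<mu>) * (L - (1 - \<mu>)) = 0"
    using \<open>\<mu> \<le> L\<close> \<mu> unfolding root[symmetric] by (simp add: field_simps)
  then have "L = \<mu>"
    using \<open>\<mu> \<le> L\<close> \<mu> by auto
  then show "(\<lambda>n. d_shift \<alpha> (Suc (Suc n)) / d_shift \<alpha> (Suc n)) \<longlonglongrightarrow> \<mu>"
    using L by (simp add: r_def[abs_def] del: d_shift.simps)
qed

lemma d_shift_quotient_tendsto:
  assumes "0 < \<alpha>" "\<alpha> \<le> 1 / 2"
  shows "(\<lambda>n. d_shift \<alpha> (Suc n) / d_shift \<alpha> (Suc (n + q))) \<longlonglongrightarrow>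
    (2 / (1 + sqrt (1 - 4 * \<alpha>\<^sup>2))) ^ q"
proof (induction q)
  case 0
  have "d_shift \<alpha> (Suc n) \<noteq> 0" for n
    using d_shift_ratio(1)[OF assms, of n] by simp
  then show ?case by simp
next
  case (Suc q)
  let ?s = "sqrt (1 - 4 * \<alpha>\<^sup>2)"
  have nz: "d_shift \<alpha> (Suc n) \<noteq> 0" for n
    using d_shift_ratio(1)[OF assms, of n] by simp
  have "\<alpha>\<^sup>2 \<le> (1 / 2)\<^sup>2"
    using assms by (intro power_mono) simp_all
  then have "0 \<le> ?s"
    by (simp add: power2_eq_square)
  then have "0 < 1 + ?s"
    by linarith
  then have "(1 + ?s) / 2 \<noteq> 0"
    by (metis half_gt_zero less_irrefl)
  then have "(\<lambda>n. inverse (d_shift \<alpha> (Suc (Suc n)) / d_shift \<alpha> (Suc n))) \<longlonglongrightarrow>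
      inverse ((1 + ?s) / 2)"
    by (intro tendsto_inverse d_shift_ratio(2)[OF assms])
  then have "(\<lambda>n. d_shift \<alpha> (Suc n) / d_shift \<alpha> (Suc (Suc n))) \<longlonglongrightarrow> 2 / (1 + ?s)"
    by (simp del: d_shift.simps)
  \<comment> \<open>Shifting the induction hypothesis by one makes the inner \<open>d_shift\<close>
    values cancel.\<close>
  from tendsto_mult[OF this LIMSEQ_Suc[OF Suc]] show ?case
    using nz by (simp add: nz del: d_shift.simps)
qed

section \<open>The limit of the Katz index\<close>

lemma path_katz_index_tendsto:
  fixes i j :: nat and \<alpha> :: real
  defines "p \<equiv> min i j" and "q \<equiv> max i j"
  assumes "1 \<le> i" "1 \<le> j"
    and adm: "\<forall>n\<ge>max i j. katz_admissible n (path_edges n) \<alpha>"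
  shows "(\<lambda>n. katz_index n (path_edges n) \<alpha> i j) \<longlonglongrightarrow>
    \<alpha> ^ (q - p) * d_poly (p - 1) \<alpha> * (2 / (1 + sqrt (1 - 4 * \<alpha>\<^sup>2))) ^ q - (if i = j then 1 else 0)"
proof -
  have "0 < \<alpha>"
    using adm unfolding katz_admissible_def by blast
  \<comment> \<open>Admissibility from \<open>n = q\<close> on concerns \<open>d n\<close>, which is
    \<open>d_shift\<close> at \<open>Suc n\<close>; hence the threshold
    \<open>Suc q\<close>.\<close>
  have "0 < d_shift \<alpha> n" if "Suc q \<le> n" for n
  proof -
    obtain m where m: "n = Suc m" "q \<le> m"
      using \<open>Suc q \<le> n\<close> by (cases n) auto
    then have "1 \<le> m" using assms by simp
    then show ?thesis
      using d_shift_pos_of_admissible adm m by (simp add: q_def del: d_shift.simps)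
  qed
  with \<open>0 < \<alpha>\<close> have half: "\<alpha> \<le> 1 / 2"
    by (rule admissible_parameter_le_half)
  let ?k = "\<lambda>n. \<alpha> ^ (q - p) * d_poly (p - 1) \<alpha> * (d_shift \<alpha> (Suc n) / d_shift \<alpha> (Suc (n + q))) -
    (if i = j then 1 else 0)"
  have "?k \<longlonglongrightarrow> \<alpha> ^ (q - p) * d_poly (p - 1) \<alpha> * (2 / (1 + sqrt (1 - 4 * \<alpha>\<^sup>2))) ^ q -
    (if i = j then 1 else 0)"
    by (intro tendsto_intros d_shift_quotient_tendsto \<open>0 < \<alpha>\<close> half)
  \<comment> \<open>Passing to \<open>n + q\<close> removes truncated subtraction: the last kernel
    factor becomes \<open>d_shift \<alpha> (Suc n)\<close>.\<close>
  moreover have "katz_index (n + q) (path_edges (n + q)) \<alpha> i j = ?k n" for n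
  proof -
    have "p = Suc (p - 1)" using assms by simp
    then have p: "d_shift \<alpha> p = d_poly (p - 1) \<alpha>"
      by (metis d_shift_Suc)
    have "path_kernel \<alpha> (n + q) i j = \<alpha> ^ (q - p) * d_poly (p - 1) \<alpha> * d_shift \<alpha> (Suc n)"
      unfolding path_kernel_def p_def[symmetric] q_def[symmetric] by (simp add: p)
    moreover have "i \<le> n + q" "j \<le> n + q" "max i j \<le> n + q"
      by (auto simp: q_def)
    ultimately show ?thesis
      using path_katz_index[of "n + q" \<alpha> i j] assms by simp
  qed
  ultimately have "(\<lambda>n. katz_index (n + q) (path_edges (n + q)) \<alpha> i j) \<longlonglongrightarrow>
      \<alpha> ^ (q - p) * d_poly (p - 1) \<alpha> * (2 / (1 + sqrt (1 - 4 * \<alpha>\<^sup>2))) ^ q - (if i = j then 1 else 0)"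
    by simp
  then show ?thesis
    by (rule LIMSEQ_offset)
qed

text \<open>The closed form includes the walk of length 0, which the Katz matrix omits: hence the -1
  for \<open>i = j\<close>. For \<open>j < i\<close>, symmetry exchanges the vertices, whereas
  \<open>j - i\<close> would truncate to 0.\<close>

theorem theorem5:
  fixes i j :: nat and \<alpha> :: real
  assumes "1 \<le> i" and "1 \<le> j"
    and "\<forall>n\<ge>max i j. katz_admissible n (path_edges n) \<alpha>"
  shows "convergent (\<lambda>n. katz_index n (path_edges n) \<alpha> i j) \<and>
    (i < j \<longrightarrow>
      (\<lambda>n. katz_index n (path_edges n) \<alpha> i j) \<longlonglongrightarrow>
        \<alpha> ^ (j - i) * d_poly (i - 1) \<alpha> * (2 / (1 + sqrt (1 - 4 * \<alpha>\<^sup>2))) ^ j) \<and>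
    (i = j \<longrightarrow>
      (\<lambda>n. katz_index n (path_edges n) \<alpha> i j) \<longlonglongrightarrow>
        \<alpha> ^ (j - i) * d_poly (i - 1) \<alpha> * (2 / (1 + sqrt (1 - 4 * \<alpha>\<^sup>2))) ^ j - 1) \<and>
    (j < i \<longrightarrow>
      (\<lambda>n. katz_index n (path_edges n) \<alpha> i j) \<longlonglongrightarrow>
        \<alpha> ^ (i - j) * d_poly (j - 1) \<alpha> * (2 / (1 + sqrt (1 - 4 * \<alpha>\<^sup>2))) ^ i)"
  using path_katz_index_tendsto[OF assms]
  by (auto simp: convergent_def max_def min_def)

end
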